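(* Let $f\in\mathcal{U}$ with $f(z)=z+a_2z^2+a_3z^3+\cdots$, and suppose that $\frac{5}{4}\leq |a_2|\leq 2$. Then the function $$g(z)=\frac{(z/f(z))-1}{-a_2}$$ belongs to $\mathcal{U}$ in the disc $$|z|<\sqrt{\frac{1-|a_2|+\sqrt{|a_2|^2+2|a_2|-3}}{2}},$$ i.e., $\left|\left(\frac{z}{g(z)}\right)^2g'(z)-1\right|<1$ for all $z$ in this disc.
   Context: Let $\mathbb{D}=\{z\in\mathbb{C}:|z|<1\}$. $\mathcal{A}$ is the family of all analytic functions $f$ in $\mathbb{D}$ with $f(0)=0=f'(0)-1$, i.e. $f(z)=z+a_2z^2+a_3z^3+\cdots$. $\mathcal{U}$ is the set of all $f\in\mathcal{A}$ satisfying $\left|\left(\frac{z}{f(z)}\right)^2f'(z)-1\right|<1$ for all $z\in\mathbb{D}$ (where $z/f(z)$ is given the value $1$ at $z=0$; the condition includes $f(z)\neq0$ for $0<|z|<1$). Likewise $z/g(z)$ is given the value $1$ at $z=0$, and the condition that $g$ belongs to $\mathcal{U}$ in a disc $|z|<R$ includes that $g(z)\neq 0$ for $0<|z|<R$. *)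

theory Defs
  imports "HOL-Complex_Analysis.Complex_Analysis"
begin

definition class_A :: "real \<Rightarrow> (complex \<Rightarrow> complex) set" where
  "class_A R = {f. f analytic_on ball 0 R \<and> f 0 = 0 \<and> deriv f 0 = 1}"

(* z / f(z), with the removable singularity at the origin filled in: for f(0) = 0, f'(0) = 1
   the limit there is 1, whereas HOL division would give 0 / 0 = 0. *)
definition ratio :: "(complex \<Rightarrow> complex) \<Rightarrow> complex \<Rightarrow> complex" where
  "ratio f z = (if z = 0 then 1 else z / f z)"

(* The radius is a parameter, so that "f belongs to U in the disc |z| < R" is f \<in> class_U R;
   the class U itself is class_U 1. Nonvanishing is explicit, because x / 0 = 0 in HOL would
   not by itself exclude zeros of f. *)
definition class_U :: "real \<Rightarrow> (complex \<Rightarrow> complex) set" where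
  "class_U R = {f \<in> class_A R.
     (\<forall>z\<in>ball 0 R. z \<noteq> 0 \<longrightarrow> f z \<noteq> 0) \<and>
     (\<forall>z\<in>ball 0 R. cmod ((ratio f z)\<^sup>2 * deriv f z - 1) < 1)}"

end

theory Submission
  imports Defs
begin

text \<open>
  Put \<open>h(z) = z / f(z)\<close> and write \<open>h(z) = 1 - a\<^sub>2 z - z\<^sup>2 V(z)\<close>. The functional defining the class is
  \<open>h - z h' - 1 = z\<^sup>2 (z V)'\<close>, so the maximum principle turns membership of \<open>f\<close> in the class into
  \<open>\<bar>(z V)'\<bar> \<le> 1\<close>, and hence \<open>\<bar>V\<bar> \<le> 1\<close>. On the other hand \<open>g(z) = z (1 + z V(z) / a\<^sub>2)\<close>, whose functional is
  \<open>(a\<^sub>2 z\<^sup>2 V' - (z V)\<^sup>2) / (a\<^sub>2 + z V)\<^sup>2\<close>. With \<open>w = \<bar>z V\<bar>\<close>, \<open>r = \<bar>z\<bar>\<close> and the Schwarz-Pick estimate for \<open>V'\<close>,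
  this is smaller than 1 in modulus as soon as \<open>(r\<^sup>2 - w\<^sup>2) / (1 - r\<^sup>2) + 2 w < \<bar>a\<^sub>2\<bar>\<close>.
  The left-hand side is largest at \<open>w = 1 - r\<^sup>2\<close>, which leaves \<open>r\<^sup>4 < (\<bar>a\<^sub>2\<bar> - 1) (1 - r\<^sup>2)\<close>,
  that is, \<open>r\<close> is below the stated radius.
\<close>

section \<open>Maximum principle and Schwarz-Pick estimate\<close>

text \<open>On the circle of radius \<open>s\<close> the hypothesis reads
  \<open>norm (f \<zeta>) \<le> 1 / s ^ n\<close>. The maximum principle carries this inside, and
  \<open>s\<close> tends to 1.\<close>

lemma norm_le_of_power_mult_norm_le:
  fixes f :: "complex \<Rightarrow> complex"
  assumes "f holomorphic_on ball 0 1"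
    and le: "\<And>z. norm z < 1 \<Longrightarrow> norm (z ^ n * f z) \<le> 1"
    and z: "norm z < 1"
  shows "norm (f z) \<le> 1"
proof (rule tendsto_upperbound)
  show "((\<lambda>s. norm (f z) * s ^ n) \<longlongrightarrow> norm (f z)) (at_left 1)"
    by (auto intro!: tendsto_eq_intros)
  have "norm (f z) * s ^ n \<le> 1" if s: "s \<in> {norm z<..<1}" for s
  proof -
    have "0 < s" using s by (auto intro: le_less_trans[OF norm_ge_zero])
    have "norm (f z) \<le> 1 / s ^ n"
    proof (rule maximum_modulus_frontier[where f = f and S = "cball 0 s"])
      have "f holomorphic_on cball 0 s"
        using assms(1) s by (auto intro: holomorphic_on_subset)
      then show "f holomorphic_on interior (cball 0 s)" "continuous_on (closure (cball 0 s)) f"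
        by (auto intro: holomorphic_on_subset holomorphic_on_imp_continuous_on)
      fix \<zeta> :: complex
      assume "\<zeta> \<in> frontier (cball 0 s)"
      then show "norm (f \<zeta>) \<le> 1 / s ^ n"
        using le[of \<zeta>] s \<open>0 < s\<close> by (auto simp: norm_mult norm_power field_simps)
    qed (use s in auto)
    then show ?thesis using \<open>0 < s\<close> by (simp add: field_simps)
  qed
  then show "\<forall>\<^sub>F s in at_left 1. norm (f z) * s ^ n \<le> 1"
    using eventually_at_left_real[OF z] by (rule eventually_mono[rotated]) auto
qed simp

lemma Schwarz_Pick_deriv_strict:
  fixes f :: "complex \<Rightarrow> complex"
  assumes holf: "f holomorphic_on ball 0 1"
    and lt: "\<And>z. norm z < 1 \<Longrightarrow> norm (f z) < 1"
    and z: "norm z < 1"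
  shows "norm (deriv f z) * (1 - (norm z)\<^sup>2) \<le> 1 - (norm (f z))\<^sup>2"
proof -
  define c where "c = f z"
  \<comment> \<open>The inner automorphism sends 0 to \<open>z\<close>, the outer one sends
    \<open>c\<close> to 0, so \<open>F\<close> fixes 0 and the Schwarz lemma bounds its derivative
    there.\<close>
  define F where "F = Moebius_function 0 c \<circ> (f \<circ> Moebius_function 0 (- z))"
  have c: "norm c < 1" using lt z by (simp add: c_def)
  have sq: "1 - cnj u * u = of_real (1 - (norm u)\<^sup>2)" for u :: complex
    using complex_norm_square[of u] by (simp add: mult.commute)
  have pos: "(norm u)\<^sup>2 < 1" if "norm u < 1" for u :: complex
    using that by (simp add: abs_square_less_1)
  have ne: "1 - cnj c * c \<noteq> 0"
    using pos[OF c] unfolding sq of_real_eq_0_iff by linarith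
  have Mz: "norm (Moebius_function 0 (- z) w) < 1" if "norm w < 1" for w
    using Moebius_function_norm_lt_1[of "- z" w 0] z that by simp
  have "F holomorphic_on ball 0 1"
    unfolding F_def
  proof (rule holomorphic_on_compose_gen[where t = "ball 0 1"])
    show "f \<circ> Moebius_function 0 (- z) holomorphic_on ball 0 1"
      by (rule holomorphic_on_compose_gen[OF Moebius_function_holomorphic holf])
         (use z Mz in \<open>simp_all add: image_subset_iff\<close>)
    show "(f \<circ> Moebius_function 0 (- z)) ` ball 0 1 \<subseteq> ball 0 1"
      by (simp add: image_subset_iff lt Mz)
  qed (rule Moebius_function_holomorphic[OF c])
  moreover have F0: "F 0 = 0"
    by (simp add: F_def c_def Moebius_function_of_zero Moebius_function_eq_zero)
  moreover have "norm (F w) < 1" if "norm w < 1" for w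
    unfolding F_def o_def by (intro Moebius_function_norm_lt_1 c lt Mz that)
  ultimately have "norm (deriv F 0) \<le> 1"
    by (rule Schwarz_Lemma(2)[where \<xi> = 0]) auto
  have d1: "(Moebius_function 0 (- z) has_field_derivative 1 - cnj z * z) (at 0)"
    unfolding Moebius_function_simple[abs_def]
    by (auto intro!: derivative_eq_intros simp: algebra_simps)
  have "(f has_field_derivative deriv f z) (at z)"
    using holf z by (auto intro: holomorphic_derivI[OF _ open_ball])
  then have "(f has_field_derivative deriv f z) (at (Moebius_function 0 (- z) 0))"
    by (simp add: Moebius_function_of_zero)
  from DERIV_chain[OF this d1]
  have d2: "(f \<circ> Moebius_function 0 (- z) has_field_derivative deriv f z * (1 - cnj z * z)) (at 0)" .
  have "(Moebius_function 0 c has_field_derivative 1 / (1 - cnj c * c)) (at c)"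
    unfolding Moebius_function_simple[abs_def] using ne
    by (auto intro!: derivative_eq_intros simp: divide_simps)
  then have "(Moebius_function 0 c has_field_derivative 1 / (1 - cnj c * c))
      (at ((f \<circ> Moebius_function 0 (- z)) 0))"
    by (simp add: Moebius_function_of_zero c_def)
  from DERIV_chain[OF this d2]
  have "deriv F 0 = 1 / (1 - cnj c * c) * (deriv f z * (1 - cnj z * z))"
    unfolding F_def by (rule DERIV_imp_deriv)
  then have "norm (deriv F 0) = norm (deriv f z) * (1 - (norm z)\<^sup>2) / (1 - (norm c)\<^sup>2)"
    using pos[OF c] pos[OF z] unfolding sq by (simp add: norm_mult norm_divide del: of_real_diff)
  with \<open>norm (deriv F 0) \<le> 1\<close> show ?thesis
    using pos[OF c] by (simp add: field_simps c_def)
qed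

text \<open>The strict version applies to \<open>s * f\<close> for \<open>0 < s < 1\<close>. Letting
  \<open>s\<close> tend to 1 also covers values of modulus 1, where the Moebius map would
  degenerate.\<close>

lemma Schwarz_Pick_deriv:
  fixes f :: "complex \<Rightarrow> complex"
  assumes holf: "f holomorphic_on ball 0 1"
    and le: "\<And>z. norm z < 1 \<Longrightarrow> norm (f z) \<le> 1"
    and z: "norm z < 1"
  shows "norm (deriv f z) * (1 - (norm z)\<^sup>2) \<le> 1 - (norm (f z))\<^sup>2"
proof (rule tendsto_le)
  show "((\<lambda>s. s * norm (deriv f z) * (1 - (norm z)\<^sup>2)) \<longlongrightarrow> norm (deriv f z) * (1 - (norm z)\<^sup>2))
      (at_left 1)"
    "((\<lambda>s. 1 - (s * norm (f z))\<^sup>2) \<longlongrightarrow> 1 - (norm (f z))\<^sup>2) (at_left 1)"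
    by (auto intro!: tendsto_eq_intros)
  have "s * norm (deriv f z) * (1 - (norm z)\<^sup>2) \<le> 1 - (s * norm (f z))\<^sup>2" if s: "s \<in> {0<..<1}" for s
  proof -
    have "norm (of_real s * f w) < 1" if "norm w < 1" for w
      using le_less_trans[OF mult_left_le[OF le[OF that], of s], of 1] s by (simp add: norm_mult)
    moreover have "(\<lambda>w. of_real s * f w) holomorphic_on ball 0 1"
      by (intro holomorphic_intros holf)
    moreover have "deriv (\<lambda>w. of_real s * f w) z = of_real s * deriv f z"
      using holf z by (intro deriv_cmult) (auto intro: holomorphic_on_imp_differentiable_at)
    ultimately show ?thesis
      using Schwarz_Pick_deriv_strict[of "\<lambda>w. of_real s * f w" z] z s by (simp add: norm_mult)
  qed
  then show "\<forall>\<^sub>F s in at_left 1. s * norm (deriv f z) * (1 - (norm z)\<^sup>2) \<le> 1 - (s * norm (f z))\<^sup>2"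
    using eventually_at_left_real[of 0 "1::real"] by (auto elim: eventually_mono)
qed simp

section \<open>Representation of z / f(z) through a bounded function\<close>

text \<open>Applied twice, this exposes \<open>a 2\<close> as the value at 0 of a holomorphic
  function.\<close>

lemma power_series_divide:
  fixes a :: "nat \<Rightarrow> complex"
  assumes "\<And>z. z \<in> ball 0 r \<Longrightarrow> (\<lambda>n. a n * z ^ n) sums f z"
  obtains g where "\<And>z. z \<in> ball 0 r \<Longrightarrow> (\<lambda>n. a (Suc n) * z ^ n) sums g z"
    and "\<And>z. z \<in> ball 0 r \<Longrightarrow> f z = a 0 + z * g z"
proof
  define g where "g z = (if z = 0 then a 1 else (f z - a 0) / z)" for z
  fix z :: complex
  assume z: "z \<in> ball 0 r"
  show *: "(\<lambda>n. a (Suc n) * z ^ n) sums g z"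
  proof (cases "z = 0")
    case True
    then show ?thesis
      using powser_sums_zero[of "\<lambda>n. a (Suc n)"] by (simp add: g_def)
  next
    case False
    have "(\<lambda>n. a (Suc n) * z ^ Suc n) sums (f z - a 0)"
      using assms[OF z] by (subst sums_Suc_iff) simp
    from sums_divide[OF this, of z] False show ?thesis
      by (simp add: g_def)
  qed
  have "(\<lambda>n. a n * z ^ n) sums a 0" if "z = 0"
    using powser_sums_zero[of a] that by simp
  then show "f z = a 0 + z * g z"
    using sums_unique2[OF assms[OF z]] by (cases "z = 0") (auto simp: g_def)
qed

lemma holomorphic_divide_out:
  assumes "f holomorphic_on S" "open S"
  obtains g where "g holomorphic_on S" "\<And>z. f z = f a + (z - a) * g z"
proof
  show "(\<lambda>z. if z = a then deriv f a else (f z - f a) / (z - a)) holomorphic_on S"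
    by (rule pole_lemma_open[OF assms])
qed auto

text \<open>Differentiating h = z/f gives h' = (f - z f')/f^2, so z h' = h - h^2 f'. Away from 0,
  \<open>ratio f\<close> is locally the plain quotient.\<close>

lemma ratio_squared_deriv:
  assumes "(f has_field_derivative f') (at z)" "f z \<noteq> 0" "z \<noteq> 0"
    and h: "(h has_field_derivative h') (at z)"
    and eq: "\<forall>\<^sub>F w in nhds z. ratio f w = h w"
  shows "(ratio f z)\<^sup>2 * f' = h z - z * h'"
proof -
  have "((\<lambda>w. w / f w) has_field_derivative (1 * f z - z * f') / (f z * f z)) (at z)"
    using assms by (intro derivative_intros) auto
  moreover have "\<forall>\<^sub>F w in nhds z. w / f w = h w"
    using eq t1_space_nhds[OF assms(3)] by eventually_elim (simp add: ratio_def)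
  ultimately have "(h has_field_derivative (1 * f z - z * f') / (f z * f z)) (at z)"
    using DERIV_cong_ev[OF refl _ refl] by fast
  from DERIV_unique[OF h this] have "h' = (f z - z * f') / (f z)\<^sup>2"
    by (simp add: power2_eq_square)
  moreover have "h z = z / f z"
    using eventually_nhds_x_imp_x[OF eq] assms(3) by (simp add: ratio_def)
  ultimately show ?thesis
    using assms(2,3) by (simp add: ratio_def diff_divide_distrib right_diff_distrib power2_eq_square)
qed

text \<open>Writing f = z (1 + z G) gives z/f = 1 - z q with q = G/(1 + z G) and q(0) =
  \<open>a 2\<close>. Then \<open>V\<close> is the difference quotient of q at 0.\<close>

lemma class_U_representation:
  assumes f: "f \<in> class_U 1"
    and a: "\<And>z. z \<in> ball 0 1 \<Longrightarrow> (\<lambda>n. a n * z ^ n) sums f z"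
  obtains V where "V holomorphic_on ball 0 1"
    and "\<And>z. norm z < 1 \<Longrightarrow> norm (V z) \<le> 1"
    and "\<And>z. norm z < 1 \<Longrightarrow> ratio f z = 1 - a 2 * z - z\<^sup>2 * V z"
proof -
  have f_an: "f analytic_on ball 0 1" and f0: "f 0 = 0" and f'0: "deriv f 0 = 1"
    and f_nz: "\<And>z. norm z < 1 \<Longrightarrow> z \<noteq> 0 \<Longrightarrow> f z \<noteq> 0"
    and f_lt: "\<And>z. norm z < 1 \<Longrightarrow> norm ((ratio f z)\<^sup>2 * deriv f z - 1) < 1"
    using f by (auto simp: class_U_def class_A_def)
  obtain F where F: "\<And>z. z \<in> ball 0 1 \<Longrightarrow> (\<lambda>n. a (Suc n) * z ^ n) sums F z"
    and fF: "\<And>z. z \<in> ball 0 1 \<Longrightarrow> f z = a 0 + z * F z"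
    using power_series_divide[OF a] by blast
  obtain G where G: "\<And>z. z \<in> ball 0 1 \<Longrightarrow> (\<lambda>n. a (Suc (Suc n)) * z ^ n) sums G z"
    and FG: "\<And>z. z \<in> ball 0 1 \<Longrightarrow> F z = a (Suc 0) + z * G z"
    using power_series_divide[OF F] by blast
  have holF: "F holomorphic_on ball 0 1" and holG: "G holomorphic_on ball 0 1"
    using F G by (auto intro!: power_series_holomorphic)
  have a0: "a 0 = 0" using fF[of 0] f0 by simp
  have "((\<lambda>z. z * F z) has_field_derivative F 0) (at 0)"
    using holomorphic_derivI[OF holF open_ball, of 0] by (auto intro!: derivative_eq_intros)
  then have "(f has_field_derivative F 0) (at 0)"
    by (rule has_field_derivative_transform_within_open[where S = "ball 0 1"]) (simp_all add: fF a0)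
  then have a1: "a (Suc 0) = 1"
    using f'0 FG[of 0] by (simp add: DERIV_imp_deriv)
  have G0: "G 0 = a 2"
    using sums_unique2[OF G[of 0] powser_sums_zero] by (simp add: numeral_2_eq_2)
  have F_nz: "1 + z * G z \<noteq> 0" if "norm z < 1" for z
    using f_nz[OF that] fF[of z] FG[of z] that a0 a1 by (cases "z = 0") auto
  define q where "q z = G z / (1 + z * G z)" for z
  have "q holomorphic_on ball 0 1"
    unfolding q_def using F_nz by (intro holomorphic_intros holG) auto
  then obtain V where holV: "V holomorphic_on ball 0 1" and V: "\<And>z. q z = q 0 + (z - 0) * V z"
    using holomorphic_divide_out[of q "ball 0 1" 0] by auto
  have ratio: "ratio f z = 1 - a 2 * z - z\<^sup>2 * V z" if z: "norm z < 1" for z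
  proof -
    have "ratio f z = 1 / (1 + z * G z)"
      using fF[of z] FG[of z] z a0 a1 by (auto simp: ratio_def)
    also have "\<dots> = 1 - z * q z"
      using F_nz[OF z] by (simp add: q_def field_simps)
    also have "\<dots> = 1 - z * (a 2 + z * V z)"
      using V[of z] by (simp add: q_def G0)
    finally show ?thesis by (simp add: algebra_simps power2_eq_square)
  qed
  have dV: "(V has_field_derivative deriv V z) (at z)" if "norm z < 1" for z
    using holomorphic_derivI[OF holV open_ball, of z] that by auto
  \<comment> \<open>In h - z h' - 1 the terms in 1 and \<open>a 2\<close> cancel, leaving z^2 (z
    V)'.\<close>
  have "norm (z ^ 2 * (V z + z * deriv V z)) \<le> 1" if z: "norm z < 1" for z
  proof (cases "z = 0")
    case False
    have "(ratio f z)\<^sup>2 * deriv f z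
        = (1 - a 2 * z - z\<^sup>2 * V z) - z * (- a 2 - (2 * z * V z + z\<^sup>2 * deriv V z))"
    proof (rule ratio_squared_deriv)
      show "(f has_field_derivative deriv f z) (at z)"
        using f_an z by (auto intro!: holomorphic_derivI[OF _ open_ball] analytic_imp_holomorphic)
      show "((\<lambda>z. 1 - a 2 * z - z\<^sup>2 * V z) has_field_derivative
          - a 2 - (2 * z * V z + z\<^sup>2 * deriv V z)) (at z)"
        using dV[OF z] by (auto intro!: derivative_eq_intros simp: algebra_simps)
      show "\<forall>\<^sub>F w in nhds z. ratio f w = 1 - a 2 * w - w\<^sup>2 * V w"
        using eventually_nhds_in_open[OF open_ball, of z 0 1] z
        by (auto elim!: eventually_mono simp: ratio)
    qed (use False f_nz z in auto)
    then have "(ratio f z)\<^sup>2 * deriv f z - 1 = z ^ 2 * (V z + z * deriv V z)"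
      by (simp add: algebra_simps power2_eq_square)
    then show ?thesis using f_lt[OF z] by simp
  qed simp
  then have W'_le: "norm (V z + z * deriv V z) \<le> 1" if "norm z < 1" for z
    by (rule norm_le_of_power_mult_norm_le[where n = 2, rotated])
       (use that in \<open>auto intro!: holomorphic_intros holV\<close>)
  \<comment> \<open>The function z V vanishes at 0 and has derivative bounded by 1, so its modulus
    is at most that of z. At 0 the derivative of z V is \<open>V 0\<close> itself.\<close>
  have V_le: "norm (V z) \<le> 1" if z: "norm z < 1" for z
  proof (cases "z = 0")
    case True
    then show ?thesis using W'_le[of 0] by simp
  next
    case False
    have "((\<lambda>w. w * V w) has_field_derivative V w + w * deriv V w) (at w within ball 0 1)"
      if "w \<in> ball 0 1" for w
    proof (rule has_field_derivative_at_within)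
      have "norm w < 1" using that by simp
      from dV[OF this]
      show "((\<lambda>w. w * V w) has_field_derivative V w + w * deriv V w) (at w)"
        by (auto intro!: derivative_eq_intros)
    qed
    moreover have "norm (V w + w * deriv V w) \<le> 1" if "w \<in> ball 0 1" for w
      using W'_le that by simp
    ultimately have "norm (z * V z - 0 * V 0) \<le> 1 * norm (z - 0)"
      using z by (intro field_differentiable_bound[where S = "ball 0 1"
            and f = "\<lambda>w. w * V w" and f' = "\<lambda>w. V w + w * deriv V w"]) auto
    then show ?thesis using False by (simp add: norm_mult)
  qed
  show ?thesis
    by (rule that[OF holV V_le ratio])
qed

section \<open>Real inequalities behind the radius\<close>

text \<open>The squared radius is the positive root of x^2 + (A - 1) x - (A - 1), whose discriminant
  is (A - 1)(A + 3). The proof completes the square.\<close>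

lemma radius_bound:
  fixes A r :: real
  assumes A: "1 < A" and r: "0 \<le> r" "r < sqrt ((1 - A + sqrt (A\<^sup>2 + 2 * A - 3)) / 2)"
  shows "(r\<^sup>2)\<^sup>2 < (A - 1) * (1 - r\<^sup>2)"
proof -
  define D where "D = A\<^sup>2 + 2 * A - 3"
  have D: "D = (A - 1) * (A + 3)" by (simp add: D_def algebra_simps power2_eq_square)
  then have "0 \<le> D" using A by simp
  have "r\<^sup>2 < (1 - A + sqrt D) / 2"
    using real_less_rsqrt r by (smt (verit) D_def real_sqrt_le_iff real_sqrt_unique)
  then have "2 * r\<^sup>2 + (A - 1) < sqrt D" by simp
  moreover have "0 \<le> 2 * r\<^sup>2 + (A - 1)" using A by simp
  ultimately have "(2 * r\<^sup>2 + (A - 1))\<^sup>2 < (sqrt D)\<^sup>2"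
    by (intro power_strict_mono) auto
  then show ?thesis
    using \<open>0 \<le> D\<close> unfolding D by (simp add: algebra_simps power2_eq_square)
qed

text \<open>AM-GM in the form \<open>2 w (1 - r\<^sup>2) \<le> w\<^sup>2 + (1 - r\<^sup>2)\<^sup>2\<close>.\<close>

lemma functional_bound:
  fixes A r v d :: real
  assumes r: "(r\<^sup>2)\<^sup>2 < (A - 1) * (1 - r\<^sup>2)" "r\<^sup>2 < 1" and A: "0 < A"
    and d: "d * (1 - r\<^sup>2) \<le> 1 - v\<^sup>2"
  shows "A * (r\<^sup>2 * d) + (r * v)\<^sup>2 < (A - r * v)\<^sup>2"
proof -
  have "r\<^sup>2 * (d * (1 - r\<^sup>2)) \<le> r\<^sup>2 * (1 - v\<^sup>2)"
    using d by (intro mult_left_mono) auto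
  moreover have "0 \<le> (r * v - (1 - r\<^sup>2))\<^sup>2" by simp
  \<comment> \<open>The terms (r v)^2 cancel, leaving the upper bound 1 - r^2 + r^4, which is below
    A (1 - r^2) by hypothesis.\<close>
  ultimately have "(r\<^sup>2 * d + 2 * (r * v)) * (1 - r\<^sup>2) < A * (1 - r\<^sup>2)"
    using r(1) by (simp add: algebra_simps power2_eq_square)
  then have "r\<^sup>2 * d + 2 * (r * v) < A" using r(2) by simp
  then have "A * (r\<^sup>2 * d + 2 * (r * v)) < A * A" using A by simp
  then show ?thesis by (simp add: algebra_simps power2_eq_square)
qed

section \<open>Passage from V to the functional of g\<close>

theorem theorem1:
  fixes f :: "complex \<Rightarrow> complex" and a :: "nat \<Rightarrow> complex"
  assumes "f \<in> class_U 1"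
    and "\<And>z. z \<in> ball 0 1 \<Longrightarrow> (\<lambda>n. a n * z ^ n) sums f z"
    and "5 / 4 \<le> cmod (a 2)" and "cmod (a 2) \<le> 2"
  shows "(\<lambda>z. (ratio f z - 1) / (- a 2)) \<in>
    class_U (sqrt ((1 - cmod (a 2) + sqrt ((cmod (a 2))\<^sup>2 + 2 * cmod (a 2) - 3)) / 2))"
proof -
  define A where "A = cmod (a 2)"
  define R where "R = sqrt ((1 - A + sqrt (A\<^sup>2 + 2 * A - 3)) / 2)"
  define g where "g = (\<lambda>z. (ratio f z - 1) / (- a 2))"
  have A: "1 < A" using assms(3) by (simp add: A_def)
  then have a2: "a 2 \<noteq> 0" by (auto simp: A_def)
  obtain V where holV: "V holomorphic_on ball 0 1"
    and V_le: "\<And>z. norm z < 1 \<Longrightarrow> norm (V z) \<le> 1"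
    and ratio: "\<And>z. norm z < 1 \<Longrightarrow> ratio f z = 1 - a 2 * z - z\<^sup>2 * V z"
    using class_U_representation[OF assms(1,2)] by blast
  have bound: "((norm z)\<^sup>2)\<^sup>2 < (A - 1) * (1 - (norm z)\<^sup>2)" if "norm z < R" for z :: complex
    using radius_bound[OF A, of "norm z"] that by (simp add: R_def)
  have sq_less: "(norm z)\<^sup>2 < 1" if "norm z < R" for z :: complex
  proof -
    have "0 < (A - 1) * (1 - (norm z)\<^sup>2)"
      using bound[OF that] zero_le_power2[of "(norm z)\<^sup>2"] by linarith
    then show ?thesis using A by (simp add: zero_less_mult_iff)
  qed
  have less_1: "norm z < 1" if "norm z < R" for z :: complex
    using sq_less[OF that] by (simp add: abs_square_less_1)
  have g: "g z = z + z\<^sup>2 * V z / a 2" if "norm z < 1" for z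
    using a2 by (simp add: g_def ratio[OF that] field_simps)
  have w_le: "norm (z * V z) < A" if "norm z < 1" for z
  proof -
    have "norm (z * V z) \<le> norm z"
      using V_le[OF that] by (simp add: norm_mult mult_left_le)
    then show ?thesis using that A by linarith
  qed
  \<comment> \<open>A zero would force \<open>norm (z * V z) = A\<close>.\<close>
  have nz: "a 2 + z * V z \<noteq> 0" if "norm z < 1" for z
    using w_le[OF that] by (auto simp: A_def add_eq_0_iff)
  have dg: "(g has_field_derivative 1 + (2 * z * V z + z\<^sup>2 * deriv V z) / a 2) (at z)"
    if z: "norm z < 1" for z
  proof (rule has_field_derivative_transform_within_open[where S = "ball 0 1"])
    have "(V has_field_derivative deriv V z) (at z)"
      using holomorphic_derivI[OF holV open_ball, of z] z by auto
    then show "((\<lambda>z. z + z\<^sup>2 * V z / a 2) has_field_derivative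
        1 + (2 * z * V z + z\<^sup>2 * deriv V z) / a 2) (at z)"
      by (auto intro!: derivative_eq_intros simp: field_simps power2_eq_square a2)
  qed (use z g in auto)
  have "g holomorphic_on ball 0 R"
    unfolding holomorphic_on_open[OF open_ball] using dg less_1 by (metis mem_ball_0)
  then have "g analytic_on ball 0 R" by (simp add: analytic_on_open)
  moreover have "g 0 = 0" "deriv g 0 = 1"
    using g[of 0] DERIV_imp_deriv[OF dg[of 0]] by auto
  moreover have g_nz: "g z \<noteq> 0" if "norm z < 1" "z \<noteq> 0" for z
  proof -
    have "g z = z * (a 2 + z * V z) / a 2"
      using g[OF that(1)] a2 by (simp add: field_simps power2_eq_square)
    then show ?thesis using nz[OF that(1)] that a2 by simp
  qed
  moreover have "norm ((ratio g z)\<^sup>2 * deriv g z - 1) < 1" if zR: "norm z < R" for z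
  proof -
    define w where "w = z * V z"
    have z: "norm z < 1" by (rule less_1[OF zR])
    have wA: "norm w < A" and w0: "a 2 + w \<noteq> 0" using w_le[OF z] nz[OF z] by (auto simp: w_def)
    \<comment> \<open>At \<open>z = 0\<close> also \<open>w = 0\<close>, and the quotient agrees
      with the default value 1 of \<open>ratio\<close>.\<close>
    have "ratio g z = a 2 / (a 2 + w)"
      using g[OF z] g_nz[OF z] a2 w0
      by (auto simp: ratio_def w_def field_simps power2_eq_square)
    moreover have "deriv g z = (a 2 + 2 * w + z\<^sup>2 * deriv V z) / a 2"
      using DERIV_imp_deriv[OF dg[OF z]] a2 by (simp add: w_def field_simps)
    ultimately have "(ratio g z)\<^sup>2 * deriv g z
        = a 2 * (a 2 + 2 * w + z\<^sup>2 * deriv V z) / (a 2 + w)\<^sup>2"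
      using a2 by (simp add: power2_eq_square)
    \<comment> \<open>Splitting off the square of the denominator isolates the deviation of the
      functional from 1.\<close>
    also have "a 2 * (a 2 + 2 * w + z\<^sup>2 * deriv V z)
        = (a 2 + w)\<^sup>2 + (a 2 * (z\<^sup>2 * deriv V z) - w\<^sup>2)"
      by (simp add: algebra_simps power2_eq_square)
    also have "\<dots> / (a 2 + w)\<^sup>2 = 1 + (a 2 * (z\<^sup>2 * deriv V z) - w\<^sup>2) / (a 2 + w)\<^sup>2"
      unfolding add_divide_distrib using w0 by simp
    finally have "(ratio g z)\<^sup>2 * deriv g z - 1
        = (a 2 * (z\<^sup>2 * deriv V z) - w\<^sup>2) / (a 2 + w)\<^sup>2" by simp
    moreover have "norm (a 2 * (z\<^sup>2 * deriv V z) - w\<^sup>2) < norm ((a 2 + w)\<^sup>2)"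
    proof -
      have "norm (a 2 * (z\<^sup>2 * deriv V z) - w\<^sup>2)
          \<le> A * ((norm z)\<^sup>2 * norm (deriv V z)) + (norm z * norm (V z))\<^sup>2"
        by (rule order_trans[OF norm_triangle_ineq4]) (simp add: A_def w_def norm_mult norm_power)
      \<comment> \<open>Schwarz-Pick supplies the bound on \<open>d = norm (deriv V z)\<close>, with
        \<open>v = norm (V z)\<close> and \<open>r = norm z\<close>.\<close>
      also have "\<dots> < (A - norm z * norm (V z))\<^sup>2"
        using bound[OF zR] sq_less[OF zR] A Schwarz_Pick_deriv[OF holV V_le z]
        by (intro functional_bound) auto
      \<comment> \<open>Reverse triangle inequality; squaring preserves it because
        \<open>norm w < A\<close>.\<close>
      also have "\<dots> \<le> (norm (a 2 + w))\<^sup>2"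
        using wA norm_diff_ineq[of "a 2" w]
        by (intro power_mono) (auto simp: A_def w_def norm_mult)
      finally show ?thesis by (simp add: norm_power)
    qed
    ultimately show ?thesis using w0 by (simp add: norm_divide)
  qed
  ultimately have "g \<in> class_U R"
    using less_1 by (simp add: class_U_def class_A_def)
  then show ?thesis by (simp add: g_def R_def A_def)
qed

end
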